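(* Let $\mathcal X=\{x_1,\dots,x_n\}$ be a set of $n$ distinct elements with a partial order $\lesssim$. For $\gamma\ge0$ let $\hat{\boldsymbol\theta}_\gamma(\mathbf y)$ be the bounded isotonic least squares estimator with boundedness parameter $\gamma$ and let $D_\gamma(\mathbf y)$ be its divergence (given by the connected-component expression in the context). Then for any given $\mathbf y\in\mathbb{R}^n$, $D_\gamma(\mathbf y)$ is nondecreasing in $\gamma\in[0,\infty)$. Consequently, $\mathrm{df}(\hat{\boldsymbol\theta}_\gamma(\mathbf y))$ is nondecreasing in $\gamma$.
   Context: $V=\{1,\dots,n\}$, $\widetilde E=\{(i,j): i\neq j,\ x_i\lesssim x_j\}$, $\max(V)=\{i\in V:\text{there is no }j\text{ with }(i,j)\in\widetilde E\}$, $\min(V)=\{i\in V:\text{there is no }j\text{ with }(j,i)\in\widetilde E\}$. The bounded isotonic estimator is $\hat{\boldsymbol\theta}_\gamma(\mathbf y)=\arg\min_{\boldsymbol\theta\in\mathcal C}\|\mathbf y-\boldsymbol\theta\|_2^2$ with $$\mathcal C=\{\boldsymbol\theta\in\mathbb{R}^n:\theta_i\le\theta_j\ \forall (i,j)\in\widetilde E,\ \ \theta_i\le\theta_j+\gamma\ \ \forall i\in\max(V),\, j\in\min(V),\, i\ne j\}.$$ Divergence: for almost every $\mathbf y$ (with $\gamma$ fixed), the divergence $\sum_{i=1}^n\frac{\partial}{\partial y_i}\hat\theta_{\gamma,i}(\mathbf y)$ equals the number of connected components of the undirected graph on vertex set $V$ whose edges are the pairs $\{i,j\}$ such that either $(i,j)\in\widetilde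 E$ and $\hat\theta_{\gamma,i}(\mathbf y)=\hat\theta_{\gamma,j}(\mathbf y)$, or $i\in\max(V)$, $j\in\min(V)$, $i\ne j$ and $\hat\theta_{\gamma,i}(\mathbf y)=\hat\theta_{\gamma,j}(\mathbf y)+\gamma$. $D_\gamma(\mathbf y)$ denotes this number of connected components, which is defined for every $\mathbf y\in\mathbb{R}^n$ and $\gamma\ge0$. Degrees of freedom: $\mathbf y=\boldsymbol\theta^*+\boldsymbol\epsilon$ with $\boldsymbol\theta^*\in\mathbb{R}^n$ fixed, $\boldsymbol\epsilon\sim N(\mathbf 0,\sigma^2I_n)$, $\sigma>0$, and $\mathrm{df}(\hat{\boldsymbol\theta}_\gamma(\mathbf y)):=\frac1{\sigma^2}\sum_{i=1}^n\mathrm{Cov}(\hat\theta_{\gamma,i}(\mathbf y),y_i)$. *)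

theory Defs
  imports "HOL-Probability.Probability"
begin

text \<open>The index set V is the (nonempty, finite) type 'n. The partial order is given as a
  relation \<open>r\<close>, where \<open>(a, b) \<in> r\<close> means that a is below b.\<close>

definition order_edges :: "('n::finite \<Rightarrow> 'a) \<Rightarrow> 'a rel \<Rightarrow> ('n \<times> 'n) set" where
  "order_edges x r = {(i, j). i \<noteq> j \<and> (x i, x j) \<in> r}"

definition max_indices :: "('n::finite \<Rightarrow> 'a) \<Rightarrow> 'a rel \<Rightarrow> 'n set" where
  "max_indices x r = {i. \<not> (\<exists>j. (i, j) \<in> order_edges x r)}"

definition min_indices :: "('n::finite \<Rightarrow> 'a) \<Rightarrow> 'a rel \<Rightarrow> 'n set" where
  "min_indices x r = {i. \<not> (\<exists>j. (j, i) \<in> order_edges x r)}"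

definition bounded_isotonic :: "('n::finite \<Rightarrow> 'a) \<Rightarrow> 'a rel \<Rightarrow> real \<Rightarrow> (real ^ 'n) set" where
  "bounded_isotonic x r \<gamma> =
     {\<theta>. (\<forall>(i, j)\<in>order_edges x r. \<theta> $ i \<le> \<theta> $ j) \<and>
         (\<forall>i\<in>max_indices x r. \<forall>j\<in>min_indices x r. i \<noteq> j \<longrightarrow> \<theta> $ i \<le> \<theta> $ j + \<gamma>)}"

text \<open>For \<open>\<gamma> \<ge> 0\<close> the constraint set is closed, convex and contains 0, so the minimiser exists
  and is unique.\<close>

definition bounded_isotonic_estimator ::
    "('n::finite \<Rightarrow> 'a) \<Rightarrow> 'a rel \<Rightarrow> real \<Rightarrow> real ^ 'n \<Rightarrow> real ^ 'n" where
  "bounded_isotonic_estimator x r \<gamma> y =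
     arg_min_on (\<lambda>\<theta>. (norm (y - \<theta>))\<^sup>2) (bounded_isotonic x r \<gamma>)"

definition active_edges ::
    "('n::finite \<Rightarrow> 'a) \<Rightarrow> 'a rel \<Rightarrow> real \<Rightarrow> real ^ 'n \<Rightarrow> ('n \<times> 'n) set" where
  "active_edges x r \<gamma> y =
     (let \<theta> = bounded_isotonic_estimator x r \<gamma> y in
       {(i, j). (i, j) \<in> order_edges x r \<and> \<theta> $ i = \<theta> $ j} \<union>
       {(i, j). i \<in> max_indices x r \<and> j \<in> min_indices x r \<and> i \<noteq> j \<and> \<theta> $ i = \<theta> $ j + \<gamma>})"

text \<open>The connected components of an undirected graph with vertex set UNIV are the classes of the
  equivalence relation generated by its edges; each undirected edge may be listed in \<open>E\<close> in
  either orientation.\<close>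

definition num_components :: "('n::finite \<times> 'n) set \<Rightarrow> nat" where
  "num_components E = card (UNIV // (E \<union> E\<inverse>)\<^sup>*)"

text \<open>For almost every \<open>y\<close> this number is the divergence, i.e. the sum of the partial derivatives
  of the i-th estimator coordinate with respect to the i-th coordinate of \<open>y\<close>; unlike these
  derivatives, it is defined for every \<open>y\<close>.\<close>

definition estimator_divergence ::
    "('n::finite \<Rightarrow> 'a) \<Rightarrow> 'a rel \<Rightarrow> real \<Rightarrow> real ^ 'n \<Rightarrow> nat" where
  "estimator_divergence x r \<gamma> y = num_components (active_edges x r \<gamma> y)"

text \<open>The law \<open>N(0, \<sigma>\<^sup>2 I)\<close>, for \<open>\<sigma> > 0\<close>. The second parameter of \<open>normal_density\<close> is the standard
  deviation, and the joint density is the product of the marginal ones.\<close>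

definition isotropic_gaussian :: "'w measure \<Rightarrow> real \<Rightarrow> ('w \<Rightarrow> real ^ 'n::finite) \<Rightarrow> bool" where
  "isotropic_gaussian M \<sigma> \<epsilon> \<longleftrightarrow>
     distributed M lborel \<epsilon> (\<lambda>z. ennreal (\<Prod>i\<in>UNIV. normal_density 0 \<sigma> (z $ i)))"

definition covariance :: "'w measure \<Rightarrow> ('w \<Rightarrow> real) \<Rightarrow> ('w \<Rightarrow> real) \<Rightarrow> real" where
  "covariance M X Y =
     (LINT w|M. (X w - (LINT v|M. X v)) * (Y w - (LINT v|M. Y v)))"

definition degrees_of_freedom ::
    "'w measure \<Rightarrow> real \<Rightarrow> ('w \<Rightarrow> real ^ 'n::finite) \<Rightarrow> (real ^ 'n \<Rightarrow> real ^ 'n) \<Rightarrow> real" where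
  "degrees_of_freedom M \<sigma> Y est =
     1 / \<sigma>\<^sup>2 * (\<Sum>i\<in>UNIV. covariance M (\<lambda>w. est (Y w) $ i) (\<lambda>w. Y w $ i))"

end

theory Submission
  imports Defs
begin

text \<open>The constraint set \<open>C \<gamma>\<close> consists of the isotonic vectors whose range (largest minus smallest
  coordinate) is at most \<open>\<gamma>\<close>, and the estimator \<open>P \<gamma>\<close> is the metric projection onto it. Everything
  rests on how two of these projections are related. If \<open>\<gamma> \<le> \<gamma>'\<close> and the range of \<open>P \<gamma>' y\<close> is at
  least \<open>\<gamma>\<close>, then \<open>P \<gamma> y\<close> arises from \<open>P \<gamma>' y\<close> by clipping all coordinates to an interval
  \<open>[a, a + \<gamma>]\<close>, placed so that clipping keeps the sum of the coordinates
  (\<open>clip_estimator\<close>); if the range is smaller, both projections coincide.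

  Clipping preserves ties between coordinates. It also sends a pair of coordinates at distance
  \<open>\<gamma>'\<close>, the whole range, to the two ends of the interval, a pair at distance \<open>\<gamma>\<close>. So every edge of
  the graph that is active for \<open>\<gamma>'\<close> is active for \<open>\<gamma>\<close> (\<open>active_edges_antimono\<close>), and a graph with
  fewer edges has at least as many components. This holds for every \<open>y\<close>, without exceptional
  points.

  The degrees of freedom are handled one coordinate at a time, through a monotonicity property that
  implies the inequality between the partial derivatives. Clipping a vector depends
  on that vector only, hence \<open>P \<gamma> (P \<gamma>' y) = P \<gamma> y\<close>. Since \<open>C \<gamma>\<close> is closed under coordinatewise
  minima and maxima and under adding constants, \<open>P \<gamma>\<close> is monotone and commutes with
  adding constants, and when only \<open>y $ i\<close> grows, no coordinate of the estimate grows by more than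
  the \<open>i\<close>-th one, by \<open>\<delta>\<close> say. Applied to \<open>P \<gamma>'\<close>, and followed by \<open>P \<gamma>\<close>, this shows that the
  \<open>i\<close>-th coordinate of \<open>P \<gamma>\<close> grows by at most \<open>\<delta>\<close> while that of \<open>P \<gamma>'\<close> grows by \<open>\<delta>\<close>. So the
  difference of the \<open>i\<close>-th coordinates is a nondecreasing function of \<open>y $ i\<close>
  (\<open>estimator_gap_mono\<close>). A function that is nondecreasing in the \<open>i\<close>-th coordinate of a centred
  isotropic Gaussian vector has nonnegative covariance with this coordinate, by reflecting the
  coordinate (\<open>isotropic_gaussian_covariance_nonneg\<close>). Summing over \<open>i\<close> gives the claim.\<close>

section \<open>The constraint set\<close>

lemma ex_max_index_above:
  fixes x :: "'n::finite \<Rightarrow> 'a"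
  assumes "inj x" and "partial_order_on (range x) r"
  obtains m where "m \<in> max_indices x r" and "m = k \<or> (k, m) \<in> order_edges x r"
proof -
  let ?E = "order_edges x r"
  have trans: "trans ?E"
    using assms
    by (auto simp: trans_def order_edges_def partial_order_on_def preorder_on_def
        dest: antisymD injD)
  moreover have "irrefl ?E"
    by (auto simp: irrefl_def order_edges_def)
  ultimately have "wf (?E\<inverse>)"
    by (intro finite_acyclic_wf_converse) (auto simp: acyclic_irrefl)
  then obtain m where "m = k \<or> (k, m) \<in> ?E" "\<And>j. (m, j) \<in> ?E \<Longrightarrow> \<not> (j = k \<or> (k, j) \<in> ?E)"
    using wfE_min[of "?E\<inverse>" k "{j. j = k \<or> (k, j) \<in> ?E}"] by auto
  then show thesis
    using that[of m] trans by (auto simp: max_indices_def dest: transD)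
qed

lemma order_edges_converse: "order_edges x (r\<inverse>) = (order_edges x r)\<inverse>"
  by (auto simp: order_edges_def)

lemma max_indices_converse: "max_indices x (r\<inverse>) = min_indices x r"
  by (auto simp: max_indices_def min_indices_def order_edges_converse)

lemma ex_min_index_below:
  fixes x :: "'n::finite \<Rightarrow> 'a"
  assumes "inj x" and "partial_order_on (range x) r"
  obtains m where "m \<in> min_indices x r" and "m = k \<or> (m, k) \<in> order_edges x r"
proof -
  have "partial_order_on (range x) (r\<inverse>)"
    using assms(2) by (auto simp: partial_order_on_def preorder_on_def refl_on_def)
  from ex_max_index_above[OF assms(1) this, of k] show thesis
    using that by (auto simp: max_indices_converse order_edges_converse)
qed

text \<open>Every value of an isotonic vector lies between its values at a minimal and at a maximal
  index, so the constraints between extremal indices bound the whole range. If the minimal index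
  found below \<open>l\<close> is also the maximal index found above \<open>k\<close>, monotonicity alone gives
  \<open>\<theta> $ k \<le> \<theta> $ l\<close>, and \<open>0 \<le> \<gamma>\<close> finishes the argument.\<close>

lemma mem_bounded_isotonic_iff:
  fixes x :: "'n::finite \<Rightarrow> 'a"
  assumes "inj x" and "partial_order_on (range x) r" and "0 \<le> \<gamma>"
  shows "\<theta> \<in> bounded_isotonic x r \<gamma> \<longleftrightarrow>
    (\<forall>(i, j)\<in>order_edges x r. \<theta> $ i \<le> \<theta> $ j) \<and> (\<forall>k l. \<theta> $ k \<le> \<theta> $ l + \<gamma>)"
proof
  assume \<theta>: "\<theta> \<in> bounded_isotonic x r \<gamma>"
  have "\<theta> $ k \<le> \<theta> $ l + \<gamma>" for k l
  proof -
    obtain m where m: "m \<in> max_indices x r" "m = k \<or> (k, m) \<in> order_edges x r"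
      using ex_max_index_above[OF assms(1,2)] .
    obtain p where p: "p \<in> min_indices x r" "p = l \<or> (p, l) \<in> order_edges x r"
      using ex_min_index_below[OF assms(1,2)] .
    have "\<theta> $ k \<le> \<theta> $ m" "\<theta> $ p \<le> \<theta> $ l"
      using \<theta> m p by (auto simp: bounded_isotonic_def)
    moreover have "\<theta> $ m \<le> \<theta> $ p + \<gamma>"
      using \<theta> m p assms(3) by (cases "m = p") (auto simp: bounded_isotonic_def)
    ultimately show ?thesis by linarith
  qed
  with \<theta> show "(\<forall>(i, j)\<in>order_edges x r. \<theta> $ i \<le> \<theta> $ j) \<and> (\<forall>k l. \<theta> $ k \<le> \<theta> $ l + \<gamma>)"
    by (auto simp: bounded_isotonic_def)
qed (auto simp: bounded_isotonic_def)

lemma bounded_isotonic_mono: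
  "\<gamma> \<le> \<gamma>' \<Longrightarrow> bounded_isotonic x r \<gamma> \<subseteq> bounded_isotonic x r \<gamma>'"
  by (fastforce simp: bounded_isotonic_def)

lemma bounded_isotonic_nonempty: "0 \<le> \<gamma> \<Longrightarrow> bounded_isotonic x r \<gamma> \<noteq> {}"
proof -
  assume "0 \<le> \<gamma>"
  then have "0 \<in> bounded_isotonic x r \<gamma>"
    by (auto simp: bounded_isotonic_def)
  then show ?thesis by blast
qed

lemma closed_bounded_isotonic: "closed (bounded_isotonic x r \<gamma>)"
proof -
  have "bounded_isotonic x r \<gamma> =
      (\<Inter>(i, j)\<in>order_edges x r. {\<theta>. \<theta> $ i \<le> \<theta> $ j}) \<inter>
      (\<Inter>i\<in>max_indices x r. \<Inter>j\<in>min_indices x r - {i}. {\<theta>. \<theta> $ i \<le> \<theta> $ j + \<gamma>})"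
    by (auto simp: bounded_isotonic_def)
  also have "closed \<dots>"
    by (intro closed_Int closed_INT ballI) (auto intro!: closed_Collect_le continuous_intros)
  finally show ?thesis .
qed

text \<open>All constraints have the form \<open>\<theta> $ i \<le> \<theta> $ j + c\<close>. The set is therefore closed under every
  operation that preserves all inequalities of this form, such as convex combinations,
  coordinatewise minima and maxima, and adding one number to all coordinates.\<close>

lemma mem_bounded_isotonic_combine:
  assumes "\<theta> \<in> bounded_isotonic x r \<gamma>" and "\<eta> \<in> bounded_isotonic x r \<gamma>"
    and "\<And>i j c. \<theta> $ i \<le> \<theta> $ j + c \<Longrightarrow> \<eta> $ i \<le> \<eta> $ j + c \<Longrightarrow> \<zeta> $ i \<le> \<zeta> $ j + c"
  shows "\<zeta> \<in> bounded_isotonic x r \<gamma>"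
proof -
  have "\<zeta> $ i \<le> \<zeta> $ j" if "(i, j) \<in> order_edges x r" for i j
    using assms(3)[of i j 0] assms(1,2) that by (force simp: bounded_isotonic_def)
  moreover have "\<zeta> $ i \<le> \<zeta> $ j + \<gamma>"
    if "i \<in> max_indices x r" "j \<in> min_indices x r" "i \<noteq> j" for i j
    using assms(3)[of i j \<gamma>] assms(1,2) that by (auto simp: bounded_isotonic_def)
  ultimately show ?thesis by (auto simp: bounded_isotonic_def)
qed

lemma convex_bounded_isotonic: "convex (bounded_isotonic x r \<gamma>)"
proof (rule convexI)
  fix \<theta> \<eta> :: "real ^ 'a" and u v :: real
  assume mem: "\<theta> \<in> bounded_isotonic x r \<gamma>" "\<eta> \<in> bounded_isotonic x r \<gamma>"
    and uv: "0 \<le> u" "0 \<le> v" "u + v = 1"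
  show "u *\<^sub>R \<theta> + v *\<^sub>R \<eta> \<in> bounded_isotonic x r \<gamma>"
  proof (rule mem_bounded_isotonic_combine[OF mem])
    fix i j c assume "\<theta> $ i \<le> \<theta> $ j + c" "\<eta> $ i \<le> \<eta> $ j + c"
    then have "u * \<theta> $ i + v * \<eta> $ i \<le> u * (\<theta> $ j + c) + v * (\<eta> $ j + c)"
      using uv by (intro add_mono mult_left_mono)
    also have "\<dots> = u * \<theta> $ j + v * \<eta> $ j + (u + v) * c"
      by (simp add: algebra_simps)
    finally show "(u *\<^sub>R \<theta> + v *\<^sub>R \<eta>) $ i \<le> (u *\<^sub>R \<theta> + v *\<^sub>R \<eta>) $ j + c"
      using uv by simp
  qed
qed

lemma min_mem_bounded_isotonic:
  assumes "\<theta> \<in> bounded_isotonic x r \<gamma>" and "\<eta> \<in> bounded_isotonic x r \<gamma>"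
  shows "(\<chi> k. min (\<theta> $ k) (\<eta> $ k)) \<in> bounded_isotonic x r \<gamma>"
  by (rule mem_bounded_isotonic_combine[OF assms]) (auto simp: min_def)

lemma max_mem_bounded_isotonic:
  assumes "\<theta> \<in> bounded_isotonic x r \<gamma>" and "\<eta> \<in> bounded_isotonic x r \<gamma>"
  shows "(\<chi> k. max (\<theta> $ k) (\<eta> $ k)) \<in> bounded_isotonic x r \<gamma>"
  by (rule mem_bounded_isotonic_combine[OF assms]) (auto simp: max_def)

lemma shift_mem_bounded_isotonic:
  assumes "\<theta> \<in> bounded_isotonic x r \<gamma>"
  shows "(\<chi> k. \<theta> $ k + c) \<in> bounded_isotonic x r \<gamma>"
  by (rule mem_bounded_isotonic_combine[OF assms assms]) simp

section \<open>The estimator as a metric projection\<close>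

lemma estimator_eq_closest_point:
  "bounded_isotonic_estimator x r \<gamma> y = closest_point (bounded_isotonic x r \<gamma>) y"
proof -
  have "(norm (y - \<eta>))\<^sup>2 < (norm (y - \<theta>))\<^sup>2 \<longleftrightarrow> \<not> dist y \<theta> \<le> dist y \<eta>" for \<theta> \<eta>
    by (simp add: dist_norm flip: not_le)
  then show ?thesis
    unfolding bounded_isotonic_estimator_def arg_min_on_def arg_min_def is_arg_min_def
      closest_point_def
    by (intro arg_cong[where f = Eps]) (auto simp: fun_eq_iff)
qed

lemma estimator_mem: "0 \<le> \<gamma> \<Longrightarrow> bounded_isotonic_estimator x r \<gamma> y \<in> bounded_isotonic x r \<gamma>"
  by (simp add: estimator_eq_closest_point closest_point_in_set closed_bounded_isotonic
      bounded_isotonic_nonempty)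

lemma estimator_inner_le:
  assumes "z \<in> bounded_isotonic x r \<gamma>"
  shows "(y - bounded_isotonic_estimator x r \<gamma> y) \<bullet> (z - bounded_isotonic_estimator x r \<gamma> y) \<le> 0"
  unfolding estimator_eq_closest_point
  using assms by (intro closest_point_dot convex_bounded_isotonic closed_bounded_isotonic)

text \<open>The variational inequality characterises the projection; all explicit solutions below are
  verified through it.\<close>

lemma estimator_eqI:
  assumes "c \<in> bounded_isotonic x r \<gamma>"
    and "\<And>z. z \<in> bounded_isotonic x r \<gamma> \<Longrightarrow> (y - c) \<bullet> (z - c) \<le> 0"
  shows "bounded_isotonic_estimator x r \<gamma> y = c"
proof -
  have "dist y c \<le> dist y z" if "z \<in> bounded_isotonic x r \<gamma>" for z
  proof -
    have "(y - z) \<bullet> (y - z) = (y - c) \<bullet> (y - c) + (z - c) \<bullet> (z - c) - 2 * ((y - c) \<bullet> (z - c))"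
      by (simp add: inner_diff_left inner_diff_right inner_commute)
    then show ?thesis
      using assms(2)[OF that] inner_ge_zero[of "z - c"]
      unfolding dist_norm norm_le by linarith
  qed
  then show ?thesis
    unfolding estimator_eq_closest_point
    using assms(1) closest_point_unique[OF convex_bounded_isotonic closed_bounded_isotonic] by metis
qed

lemma estimator_self:
  "y \<in> bounded_isotonic x r \<gamma> \<Longrightarrow> bounded_isotonic_estimator x r \<gamma> y = y"
  by (simp add: estimator_eq_closest_point closest_point_self)

lemma estimator_eq_of_mem_subset:
  assumes "0 \<le> \<gamma>'" and "\<gamma> \<le> \<gamma>'"
    and "bounded_isotonic_estimator x r \<gamma>' y \<in> bounded_isotonic x r \<gamma>"
  shows "bounded_isotonic_estimator x r \<gamma> y = bounded_isotonic_estimator x r \<gamma>' y"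
  using assms bounded_isotonic_mono[OF assms(2)]
  by (intro estimator_eqI estimator_inner_le) auto

lemma estimator_mem_of_range_le:
  fixes x :: "'n::finite \<Rightarrow> 'a"
  assumes order: "inj x" "partial_order_on (range x) r" and \<gamma>: "0 \<le> \<gamma>" "\<gamma> \<le> \<gamma>'"
    and range: "\<And>k l. bounded_isotonic_estimator x r \<gamma>' y $ k
      \<le> bounded_isotonic_estimator x r \<gamma>' y $ l + \<gamma>"
  shows "bounded_isotonic_estimator x r \<gamma>' y \<in> bounded_isotonic x r \<gamma>"
proof -
  have \<gamma>': "0 \<le> \<gamma>'" using \<gamma> by linarith
  show ?thesis
    using estimator_mem[OF \<gamma>', of x r y] range
    unfolding mem_bounded_isotonic_iff[OF order \<gamma>(1)] mem_bounded_isotonic_iff[OF order \<gamma>']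
    by blast
qed

lemma dist_estimator_le:
  "0 \<le> \<gamma> \<Longrightarrow> dist (bounded_isotonic_estimator x r \<gamma> y) (bounded_isotonic_estimator x r \<gamma> z) \<le> dist y z"
  unfolding estimator_eq_closest_point
  by (intro closest_point_lipschitz convex_bounded_isotonic closed_bounded_isotonic
      bounded_isotonic_nonempty)

lemma continuous_on_estimator:
  "0 \<le> \<gamma> \<Longrightarrow> continuous_on S (bounded_isotonic_estimator x r \<gamma>)"
  unfolding estimator_eq_closest_point[abs_def]
  by (intro continuous_on_closest_point convex_bounded_isotonic closed_bounded_isotonic
      bounded_isotonic_nonempty)

section \<open>Tightening the range by clipping\<close>

text \<open>The level comes from the intermediate value theorem: at the lowest admissible level only
  large coordinates are cut off, at the highest one only small coordinates are raised. The position
  of the interval inside the range of \<open>v\<close> is as important as the balance, because it guarantees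
  that both ends are attained after clipping.\<close>

lemma balanced_clip_level_exists:
  fixes v :: "real ^ 'n::finite"
  assumes "0 \<le> \<gamma>" and "\<gamma> \<le> v $ M - v $ m" and "\<And>k. v $ m \<le> v $ k" and "\<And>k. v $ k \<le> v $ M"
  obtains a where "v $ m \<le> a" and "a + \<gamma> \<le> v $ M"
    and "(\<Sum>k\<in>UNIV. v $ k - max a (min (a + \<gamma>) (v $ k))) = 0"
proof -
  define S where "S a = (\<Sum>k\<in>UNIV. v $ k - max a (min (a + \<gamma>) (v $ k)))" for a
  have "\<exists>a\<ge>v $ m. a \<le> v $ M - \<gamma> \<and> S a = 0"
  proof (rule IVT2')
    show "S (v $ M - \<gamma>) \<le> 0"
      unfolding S_def using assms by (intro sum_nonpos) (auto simp: min_def max_def)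
    show "0 \<le> S (v $ m)"
      unfolding S_def using assms by (intro sum_nonneg) (auto simp: min_def max_def)
    show "continuous_on {v $ m..v $ M - \<gamma>} S"
      unfolding S_def by (intro continuous_intros)
  qed (use assms in linarith)
  then show thesis using that unfolding S_def by force
qed

text \<open>Write \<open>v\<close> for the estimate with bound \<open>\<gamma>'\<close> and \<open>c\<close> for the clipped vector. The variational
  inequality for \<open>v\<close> and \<open>c\<close> compares the clipping residual \<open>v - c\<close> with a competitor \<open>z\<close>, whose
  values lie in an interval of length \<open>\<gamma>\<close> as well; the comparison reduces to the sum of the
  residual, which is zero by the choice of the level. For \<open>y\<close> in place of \<open>v\<close>, the point is that
  \<open>z + (v - c)\<close> is admissible for \<open>\<gamma>'\<close>: the residual is a nondecreasing function of \<open>v\<close>, and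
  clipping takes exactly \<open>\<gamma>\<close> out of the range of \<open>v\<close>, so at most \<open>\<gamma>' - \<gamma>\<close> remains for the
  residual. Hence the inequality for \<open>y\<close> and \<open>v\<close> can be used with this competitor.\<close>

lemma clip_estimator:
  fixes x :: "'n::finite \<Rightarrow> 'a" and r :: "'a rel" and y :: "real ^ 'n"
  defines "\<theta> \<equiv> \<lambda>\<gamma>. bounded_isotonic_estimator x r \<gamma> y"
  assumes order: "inj x" "partial_order_on (range x) r"
    and \<gamma>: "0 \<le> \<gamma>" "\<gamma> \<le> \<gamma>'"
    and range: "\<gamma> \<le> \<theta> \<gamma>' $ M - \<theta> \<gamma>' $ m"
    and m: "\<And>k. \<theta> \<gamma>' $ m \<le> \<theta> \<gamma>' $ k" and M: "\<And>k. \<theta> \<gamma>' $ k \<le> \<theta> \<gamma>' $ M"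
  obtains a where "\<theta> \<gamma>' $ m \<le> a" and "a + \<gamma> \<le> \<theta> \<gamma>' $ M"
    and "\<And>k. \<theta> \<gamma> $ k = max a (min (a + \<gamma>) (\<theta> \<gamma>' $ k))"
    and "bounded_isotonic_estimator x r \<gamma> (\<theta> \<gamma>') = \<theta> \<gamma>"
proof -
  define v where "v = \<theta> \<gamma>'"
  have \<gamma>': "0 \<le> \<gamma>'" using \<gamma> by linarith
  have mem: "v \<in> bounded_isotonic x r \<gamma>'"
    unfolding v_def \<theta>_def by (rule estimator_mem[OF \<gamma>'])
  note iff = mem_bounded_isotonic_iff[OF order]
  obtain a where a: "v $ m \<le> a" "a + \<gamma> \<le> v $ M"
    and balance: "(\<Sum>k\<in>UNIV. v $ k - max a (min (a + \<gamma>) (v $ k))) = 0"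
    using balanced_clip_level_exists[of \<gamma> v M m] \<gamma>(1) range m M unfolding v_def by blast
  define c where "c = (\<chi> k. max a (min (a + \<gamma>) (v $ k)))"
  have c_mem: "c \<in> bounded_isotonic x r \<gamma>"
    using mem unfolding iff[OF \<gamma>(1)] iff[OF \<gamma>'] c_def using \<gamma> by fastforce
  have v_c: "(v - c) \<bullet> (z - c) \<le> 0" if z: "z \<in> bounded_isotonic x r \<gamma>" for z
  proof -
    obtain l where l: "\<And>k. z $ l \<le> z $ k"
      using ex_min_if_finite[of "range (($) z)"] by (force simp: not_less)
    have "(v - c) \<bullet> (z - c) = (\<Sum>k\<in>UNIV. (v $ k - c $ k) * (z $ k - c $ k))"
      by (simp add: inner_vec_def)
    \<comment> \<open>Where \<open>c\<close> sits at the lower end \<open>a\<close>, the residual is at most zero and \<open>z\<close> is at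
      least its minimum; at the upper end \<open>a + \<gamma>\<close> the residual is at least zero and \<open>z\<close> is at most
      its minimum plus \<open>\<gamma>\<close>; elsewhere the residual vanishes. In each case the second factor may be replaced by the same constant.\<close>
    also have "\<dots> \<le> (\<Sum>k\<in>UNIV. (v $ k - c $ k) * (z $ l - a))"
    proof (rule sum_mono)
      fix k
      have "z $ l \<le> z $ k" "z $ k \<le> z $ l + \<gamma>"
        using l z unfolding iff[OF \<gamma>(1)] by auto
      then consider "v $ k < a" "c $ k = a" | "v $ k = c $ k" | "a + \<gamma> < v $ k" "c $ k = a + \<gamma>"
        using \<gamma>(1) unfolding c_def vec_lambda_beta by linarith
      then show "(v $ k - c $ k) * (z $ k - c $ k) \<le> (v $ k - c $ k) * (z $ l - a)"
      proof cases
        case 1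
        then show ?thesis using \<open>z $ l \<le> z $ k\<close> by (auto intro: mult_left_mono_neg)
      next
        case 3
        then show ?thesis using \<open>z $ k \<le> z $ l + \<gamma>\<close> by (auto intro!: mult_left_mono)
      qed simp
    qed
    also have "\<dots> = 0"
      using balance by (simp add: c_def flip: sum_distrib_right)
    finally show ?thesis .
  qed
  have y_c: "(y - c) \<bullet> (z - c) \<le> 0" if z: "z \<in> bounded_isotonic x r \<gamma>" for z
  proof -
    have isotone: "(z + (v - c)) $ i \<le> (z + (v - c)) $ j" if ij: "(i, j) \<in> order_edges x r" for i j
    proof -
      have "z $ i \<le> z $ j" "v $ i \<le> v $ j"
        using z mem ij unfolding iff[OF \<gamma>(1)] iff[OF \<gamma>'] by auto
      then show ?thesis using \<gamma>(1) unfolding c_def by (auto simp: min_def max_def)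
    qed
    have bounded: "(z + (v - c)) $ k \<le> (z + (v - c)) $ l + \<gamma>'" for k l
    proof -
      have "z $ k \<le> z $ l + \<gamma>" "v $ M \<le> v $ m + \<gamma>'"
        using z mem unfolding iff[OF \<gamma>(1)] iff[OF \<gamma>'] by auto
      moreover have "v $ k - c $ k \<le> v $ M - (a + \<gamma>)"
        using a M[of k] \<gamma> unfolding c_def v_def by (auto simp: min_def max_def)
      moreover have "v $ m - a \<le> v $ l - c $ l"
        using a m[of l] \<gamma> unfolding c_def v_def by (auto simp: min_def max_def)
      ultimately show ?thesis by simp
    qed
    have "z + (v - c) \<in> bounded_isotonic x r \<gamma>'"
      unfolding iff[OF \<gamma>'] using isotone bounded by auto
    then have "(y - v) \<bullet> (z + (v - c) - v) \<le> 0"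
      unfolding v_def \<theta>_def by (rule estimator_inner_le)
    moreover have "(y - c) \<bullet> (z - c) = (y - v) \<bullet> (z + (v - c) - v) + (v - c) \<bullet> (z - c)"
      by (simp add: algebra_simps)
    ultimately show ?thesis using v_c[OF z] by linarith
  qed
  have "\<theta> \<gamma> = c" "bounded_isotonic_estimator x r \<gamma> v = c"
    unfolding \<theta>_def using c_mem y_c v_c by (auto intro: estimator_eqI)
  then show thesis
    using that[of a] a unfolding c_def v_def by simp
qed

lemma vec_extremal_indices:
  fixes v :: "real ^ 'n::finite"
  obtains m M where "\<And>k. v $ m \<le> v $ k" and "\<And>k. v $ k \<le> v $ M"
proof -
  obtain m where "\<And>k. v $ m \<le> v $ k"
    using ex_min_if_finite[of "range (($) v)"] by (force simp: not_less)
  moreover obtain M where "\<And>k. v $ k \<le> v $ M"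
    using ex_min_if_finite[of "range (\<lambda>k. - v $ k)"] by (force simp: not_less)
  ultimately show thesis using that by blast
qed

text \<open>Both sides are the same clipping of the estimate with bound \<open>\<gamma>'\<close>. Nested projections do not
  commute in this way for general convex sets.\<close>

lemma estimator_estimator:
  fixes x :: "'n::finite \<Rightarrow> 'a"
  assumes order: "inj x" "partial_order_on (range x) r"
    and \<gamma>: "0 \<le> \<gamma>" "\<gamma> \<le> \<gamma>'"
  shows "bounded_isotonic_estimator x r \<gamma> (bounded_isotonic_estimator x r \<gamma>' y) =
    bounded_isotonic_estimator x r \<gamma> y"
proof -
  let ?v = "bounded_isotonic_estimator x r \<gamma>' y"
  have \<gamma>': "0 \<le> \<gamma>'" using \<gamma> by linarith
  obtain m M where mM: "\<And>k. ?v $ m \<le> ?v $ k" "\<And>k. ?v $ k \<le> ?v $ M"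
    using vec_extremal_indices[of ?v] by blast
  show ?thesis
  proof (cases "\<gamma> \<le> ?v $ M - ?v $ m")
    case True
    then show ?thesis using clip_estimator[OF order \<gamma> True mM] by metis
  next
    case False
    have "?v $ k \<le> ?v $ l + \<gamma>" for k l
      using mM(1)[of l] mM(2)[of k] False by linarith
    then have "?v \<in> bounded_isotonic x r \<gamma>"
      by (rule estimator_mem_of_range_le[OF order \<gamma>])
    then show ?thesis
      using estimator_self estimator_eq_of_mem_subset[OF \<gamma>' \<gamma>(2)] by metis
  qed
qed

section \<open>Monotonicity of the divergence\<close>

text \<open>If the estimate with bound \<open>\<gamma>'\<close> has range less than \<open>\<gamma>\<close>, it is unchanged for \<open>\<gamma>\<close> and none of
  its pairs of coordinates is at distance \<open>\<gamma>'\<close>. Otherwise the estimates are related by clipping,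
  and a pair at distance \<open>\<gamma>'\<close> consists of a largest and a smallest coordinate, which are clipped
  to the two ends of the interval.\<close>

lemma active_edges_antimono:
  fixes x :: "'n::finite \<Rightarrow> 'a"
  assumes order: "inj x" "partial_order_on (range x) r"
    and \<gamma>: "0 \<le> \<gamma>" "\<gamma> \<le> \<gamma>'"
  shows "active_edges x r \<gamma>' y \<subseteq> active_edges x r \<gamma> y"
proof -
  let ?v = "bounded_isotonic_estimator x r \<gamma>' y" and ?c = "bounded_isotonic_estimator x r \<gamma> y"
  have \<gamma>': "0 \<le> \<gamma>'" using \<gamma> by linarith
  obtain m M where mM: "\<And>k. ?v $ m \<le> ?v $ k" "\<And>k. ?v $ k \<le> ?v $ M"
    using vec_extremal_indices[of ?v] by blast
  have v_mem: "?v \<in> bounded_isotonic x r \<gamma>'"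
    by (rule estimator_mem[OF \<gamma>'])
  have "(\<forall>i j. ?v $ i = ?v $ j \<longrightarrow> ?c $ i = ?c $ j) \<and>
      (\<forall>i j. ?v $ i = ?v $ j + \<gamma>' \<longrightarrow> ?c $ i = ?c $ j + \<gamma>)"
  proof (cases "\<gamma> \<le> ?v $ M - ?v $ m")
    case True
    then obtain a where a: "?v $ m \<le> a" "a + \<gamma> \<le> ?v $ M"
      and c: "\<And>k. ?c $ k = max a (min (a + \<gamma>) (?v $ k))"
      using clip_estimator[OF order \<gamma> True mM] by metis
    have "?c $ i = ?c $ j + \<gamma>" if ij: "?v $ i = ?v $ j + \<gamma>'" for i j
    proof -
      have "?v $ M \<le> ?v $ m + \<gamma>'"
        using v_mem unfolding mem_bounded_isotonic_iff[OF order \<gamma>'] by blast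
      then have "?v $ i = ?v $ M" "?v $ j = ?v $ m"
        using ij mM(1)[of j] mM(2)[of i] by linarith+
      then show ?thesis using a \<gamma>(1) by (auto simp: c)
    qed
    then show ?thesis by (simp add: c)
  next
    case False
    have "?v $ k \<le> ?v $ l + \<gamma>" for k l
      using mM(1)[of l] mM(2)[of k] False by linarith
    then have "?v \<in> bounded_isotonic x r \<gamma>"
      by (rule estimator_mem_of_range_le[OF order \<gamma>])
    then have "?c = ?v"
      by (rule estimator_eq_of_mem_subset[OF \<gamma>' \<gamma>(2)])
    moreover have "?v $ i \<noteq> ?v $ j + \<gamma>'" for i j
      using mM(1)[of j] mM(2)[of i] False \<gamma> by linarith
    ultimately show ?thesis by simp
  qed
  then show ?thesis unfolding active_edges_def Let_def by blast
qed

lemma num_components_antimono: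
  assumes "E \<subseteq> F"
  shows "num_components F \<le> num_components E"
proof -
  have "equiv UNIV ((G \<union> G\<inverse>)\<^sup>*)" for G :: "('a \<times> 'a) set"
    by (intro equivI refl_rtrancl sym_rtrancl sym_Un_converse trans_rtrancl) auto
  moreover have "(E \<union> E\<inverse>)\<^sup>* \<subseteq> (F \<union> F\<inverse>)\<^sup>*"
    using assms by (intro rtrancl_mono) auto
  ultimately show ?thesis
    unfolding num_components_def by (intro finite_refines_card_le finite)
qed

section \<open>Sensitivity to a single observation\<close>

text \<open>The lattice argument: let \<open>d\<close> be the positive part of the difference \<open>w - u\<close> of the estimates
  for \<open>z\<close> and \<open>y\<close>. Moving \<open>u\<close> up by \<open>d\<close> gives the coordinatewise maximum and moving \<open>w\<close> down by \<open>d\<close>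
  the minimum, so both moves are admissible. Adding the two variational inequalities bounds
  \<open>d \<bullet> d\<close> by \<open>- ((y - z) \<bullet> d)\<close>, which is not positive if \<open>z \<le> y\<close> wherever \<open>d\<close> does not vanish.\<close>

lemma estimator_comparison:
  assumes \<gamma>: "0 \<le> \<gamma>"
    and le: "\<And>k. bounded_isotonic_estimator x r \<gamma> y $ k < bounded_isotonic_estimator x r \<gamma> z $ k
      \<Longrightarrow> z $ k \<le> y $ k"
  shows "bounded_isotonic_estimator x r \<gamma> z $ k \<le> bounded_isotonic_estimator x r \<gamma> y $ k"
proof -
  define u where "u = bounded_isotonic_estimator x r \<gamma> y"
  define w where "w = bounded_isotonic_estimator x r \<gamma> z"
  define d where "d = (\<chi> k. max 0 (w $ k - u $ k))"
  have mem: "u \<in> bounded_isotonic x r \<gamma>" "w \<in> bounded_isotonic x r \<gamma>"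
    unfolding u_def w_def using \<gamma> by (auto intro: estimator_mem)
  have "u + d = (\<chi> k. max (u $ k) (w $ k))" "w - d = (\<chi> k. min (u $ k) (w $ k))"
    by (auto simp: vec_eq_iff d_def)
  then have "u + d \<in> bounded_isotonic x r \<gamma>" "w - d \<in> bounded_isotonic x r \<gamma>"
    using mem by (auto intro: max_mem_bounded_isotonic min_mem_bounded_isotonic)
  then have "(y - u) \<bullet> d \<le> 0" "0 \<le> (z - w) \<bullet> d"
    using estimator_inner_le[of "u + d" x r \<gamma> y] estimator_inner_le[of "w - d" x r \<gamma> z]
    unfolding u_def[symmetric] w_def[symmetric] by auto
  moreover have "(w - u) \<bullet> d = d \<bullet> d"
    by (auto simp: inner_vec_def d_def max_def intro!: sum.cong)
  moreover have "0 \<le> (y - z) \<bullet> d"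
    unfolding inner_vec_def
  proof (rule sum_nonneg)
    fix k
    show "0 \<le> (y - z) $ k \<bullet> d $ k"
      using le[of k] by (cases "u $ k < w $ k") (auto simp: d_def u_def w_def max_def)
  qed
  moreover have "(y - u) \<bullet> d - (z - w) \<bullet> d = (y - z) \<bullet> d + (w - u) \<bullet> d"
    by (simp add: algebra_simps)
  ultimately have "d \<bullet> d \<le> 0" by linarith
  then have "d = 0" using inner_ge_zero[of d] by (metis inner_eq_zero_iff order_antisym)
  then have "max 0 (w $ k - u $ k) = 0"
    by (simp add: d_def vec_eq_iff)
  then show ?thesis unfolding u_def w_def by (simp add: max_def split: if_splits)
qed

lemma estimator_mono:
  assumes "0 \<le> \<gamma>" and "\<And>k. y $ k \<le> z $ k"
  shows "bounded_isotonic_estimator x r \<gamma> y $ k \<le> bounded_isotonic_estimator x r \<gamma> z $ k"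
  using assms by (intro estimator_comparison) auto

lemma estimator_shift:
  assumes "0 \<le> \<gamma>"
  shows "bounded_isotonic_estimator x r \<gamma> (\<chi> k. y $ k + c) =
    (\<chi> k. bounded_isotonic_estimator x r \<gamma> y $ k + c)"
proof (rule estimator_eqI)
  let ?u = "bounded_isotonic_estimator x r \<gamma> y"
  show "(\<chi> k. ?u $ k + c) \<in> bounded_isotonic x r \<gamma>"
    using assms by (intro shift_mem_bounded_isotonic estimator_mem)
  fix z assume "z \<in> bounded_isotonic x r \<gamma>"
  then have "(\<chi> k. z $ k + - c) \<in> bounded_isotonic x r \<gamma>"
    by (rule shift_mem_bounded_isotonic)
  then have "(y - ?u) \<bullet> ((\<chi> k. z $ k + - c) - ?u) \<le> 0"
    by (rule estimator_inner_le)
  also have "(y - ?u) \<bullet> ((\<chi> k. z $ k + - c) - ?u) =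
      ((\<chi> k. y $ k + c) - (\<chi> k. ?u $ k + c)) \<bullet> (z - (\<chi> k. ?u $ k + c))"
    by (simp add: inner_vec_def algebra_simps)
  finally show "((\<chi> k. y $ k + c) - (\<chi> k. ?u $ k + c)) \<bullet> (z - (\<chi> k. ?u $ k + c)) \<le> 0" .
qed

text \<open>Let \<open>\<delta>\<close> be the increment at \<open>i\<close>. The estimate for \<open>z\<close> is compared with the estimate for
  \<open>y + \<delta>\<close>: the data satisfy \<open>z \<le> y + \<delta>\<close> at every index except possibly \<open>i\<close>, and at \<open>i\<close> the two
  estimates agree by the choice of \<open>\<delta>\<close>.\<close>

lemma estimator_increment_le:
  fixes y z :: "real ^ 'n::finite"
  assumes \<gamma>: "0 \<le> \<gamma>" and eq: "\<And>k. k \<noteq> i \<Longrightarrow> z $ k = y $ k" and le: "y $ i \<le> z $ i"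
  shows "bounded_isotonic_estimator x r \<gamma> z $ k - bounded_isotonic_estimator x r \<gamma> y $ k
    \<le> bounded_isotonic_estimator x r \<gamma> z $ i - bounded_isotonic_estimator x r \<gamma> y $ i"
proof -
  let ?P = "bounded_isotonic_estimator x r \<gamma>"
  define \<delta> where "\<delta> = ?P z $ i - ?P y $ i"
  have "y $ k \<le> z $ k" for k
    using eq le by (cases "k = i") auto
  then have "0 \<le> \<delta>"
    unfolding \<delta>_def using estimator_mono[OF \<gamma>, of y z x r i] by simp
  have "?P z $ k \<le> ?P (\<chi> k. y $ k + \<delta>) $ k"
  proof (rule estimator_comparison[OF \<gamma>])
    fix k assume "?P (\<chi> k. y $ k + \<delta>) $ k < ?P z $ k"
    then have "k \<noteq> i" by (auto simp: estimator_shift[OF \<gamma>] \<delta>_def)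
    then show "z $ k \<le> (\<chi> k. y $ k + \<delta>) $ k" using eq \<open>0 \<le> \<delta>\<close> by simp
  qed
  then show ?thesis by (simp add: estimator_shift[OF \<gamma>] \<delta>_def)
qed

text \<open>Projecting in two stages turns the bound on the increments of the estimate with bound \<open>\<gamma>'\<close>
  into a bound on those of the estimate with bound \<open>\<gamma>\<close>, because the second stage is monotone and
  commutes with adding \<open>\<delta>\<close>.\<close>

lemma estimator_gap_mono:
  fixes x :: "'n::finite \<Rightarrow> 'a" and y z :: "real ^ 'n"
  assumes order: "inj x" "partial_order_on (range x) r"
    and \<gamma>: "0 \<le> \<gamma>" "\<gamma> \<le> \<gamma>'"
    and eq: "\<And>k. k \<noteq> i \<Longrightarrow> z $ k = y $ k" and le: "y $ i \<le> z $ i"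
  shows "bounded_isotonic_estimator x r \<gamma>' y $ i - bounded_isotonic_estimator x r \<gamma> y $ i
    \<le> bounded_isotonic_estimator x r \<gamma>' z $ i - bounded_isotonic_estimator x r \<gamma> z $ i"
proof -
  let ?P = "bounded_isotonic_estimator x r \<gamma>" and ?P' = "bounded_isotonic_estimator x r \<gamma>'"
  have \<gamma>': "0 \<le> \<gamma>'" using \<gamma> by linarith
  define \<delta> where "\<delta> = ?P' z $ i - ?P' y $ i"
  have "?P' z $ k \<le> (\<chi> k. ?P' y $ k + \<delta>) $ k" for k
    using estimator_increment_le[OF \<gamma>' eq le, of x r k] by (simp add: \<delta>_def)
  then have "?P (?P' z) $ i \<le> ?P (\<chi> k. ?P' y $ k + \<delta>) $ i"
    by (rule estimator_mono[OF \<gamma>(1)])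
  then have "?P z $ i \<le> ?P y $ i + \<delta>"
    by (simp add: estimator_shift[OF \<gamma>(1)] estimator_estimator[OF order \<gamma>])
  then show ?thesis by (simp add: \<delta>_def)
qed

section \<open>Isotropic Gaussian vectors\<close>

lemma prod_normal_density_eq:
  fixes z :: "real ^ 'n::finite"
  shows "(\<Prod>i\<in>UNIV. normal_density 0 \<sigma> (z $ i)) =
    (1 / sqrt (2 * pi * \<sigma>\<^sup>2)) ^ CARD('n) * exp (- (norm z)\<^sup>2 / (2 * \<sigma>\<^sup>2))"
proof -
  have "(\<Sum>i\<in>UNIV. - (z $ i)\<^sup>2 / (2 * \<sigma>\<^sup>2)) = - (norm z)\<^sup>2 / (2 * \<sigma>\<^sup>2)"
    unfolding power2_norm_eq_inner inner_vec_def
    by (simp add: power2_eq_square sum_negf flip: sum_divide_distrib)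
  then show ?thesis
    unfolding normal_density_def prod.distrib by (simp flip: exp_sum)
qed

text \<open>Only used to double the variance: the Gaussian with variance \<open>2 \<sigma>\<^sup>2\<close> is still integrable and
  dominates, up to a constant, the square of the norm times the original one, which gives second moments without
  computing them.\<close>

lemma integrable_lborel_scaleR:
  fixes f :: "'a::euclidean_space \<Rightarrow> real"
  assumes f: "integrable lborel f" and c: "c \<noteq> 0"
  shows "integrable lborel (\<lambda>x. f (c *\<^sub>R x))"
proof -
  have [measurable]: "f \<in> borel_measurable borel" using f by simp
  have "integrable (density (distr lborel borel (\<lambda>x. 0 + c *\<^sub>R x)) (\<lambda>_. ennreal (\<bar>c\<bar> ^ DIM('a)))) f"
    using f lborel_affine[OF c, of "0 :: 'a"] by simp
  then show ?thesis
    using c by (simp add: integrable_density integrable_distr_eq)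
qed

definition reflect :: "'n::finite \<Rightarrow> real ^ 'n \<Rightarrow> real ^ 'n" where
  "reflect i z = (\<chi> k. if k = i then - z $ k else z $ k)"

lemma norm_reflect: "norm (reflect i z) = norm z"
  unfolding norm_eq_sqrt_inner inner_vec_def reflect_def
  by (intro arg_cong[where f = sqrt] sum.cong) auto

lemma measurable_reflect [measurable]: "reflect i \<in> borel \<rightarrow>\<^sub>M borel"
proof (rule borel_measurable_continuous_onI)
  show "continuous_on UNIV (reflect i)"
    unfolding reflect_def
    by (rule continuous_on_vec_lambda, rename_tac k, case_tac "k = i") (auto intro!: continuous_intros)
qed

lemma distr_lborel_reflect: "distr lborel borel (reflect i) = lborel"
proof -
  define c :: "real ^ 'a \<Rightarrow> real" where "c j = (if j = axis i 1 then - 1 else 1)" for j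
  have "reflect i = (\<lambda>x. 0 + (\<Sum>j\<in>Basis. (c j * (x \<bullet> j)) *\<^sub>R j))"
  proof (rule ext, rule euclidean_eqI)
    fix x b :: "real ^ 'a" assume b: "b \<in> Basis"
    then obtain k where k: "b = axis k 1" by (auto simp: Basis_vec_def)
    have "(0 + (\<Sum>j\<in>Basis. (c j * (x \<bullet> j)) *\<^sub>R j)) \<bullet> b = c b * (x \<bullet> b)"
      using b by simp
    also have "\<dots> = reflect i x \<bullet> b"
      by (auto simp: k c_def reflect_def inner_axis axis_eq_axis)
    finally show "reflect i x \<bullet> b = (0 + (\<Sum>j\<in>Basis. (c j * (x \<bullet> j)) *\<^sub>R j)) \<bullet> b" ..
  qed
  moreover have "(\<Prod>j\<in>Basis. \<bar>c j\<bar>) = 1" "\<And>j. c j \<noteq> 0"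
    by (auto simp: c_def intro!: prod.neutral)
  ultimately show ?thesis
    using lborel_affine_euclidean[of c 0] by (simp add: density_1)
qed

lemma isotropic_gaussian_measurable:
  "isotropic_gaussian M \<sigma> \<epsilon> \<Longrightarrow> \<epsilon> \<in> borel_measurable M"
  unfolding isotropic_gaussian_def by (auto dest: distributed_measurable)

lemma isotropic_gaussian_square_integrable:
  fixes \<epsilon> :: "'w \<Rightarrow> real ^ 'n::finite"
  assumes "prob_space M" and \<sigma>: "0 < \<sigma>" and \<epsilon>: "isotropic_gaussian M \<sigma> \<epsilon>"
  shows "integrable M (\<lambda>w. (norm (\<epsilon> w))\<^sup>2)"
proof -
  interpret prob_space M by fact
  let ?C = "(1 / sqrt (2 * pi * \<sigma>\<^sup>2)) ^ CARD('n)"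
  let ?g = "\<lambda>z :: real ^ 'n. exp (- (norm z)\<^sup>2 / (2 * \<sigma>\<^sup>2))"
  have D: "distributed M lborel \<epsilon> (\<lambda>z. ennreal (?C * ?g z))"
    using \<epsilon> unfolding isotropic_gaussian_def prod_normal_density_eq .
  have "integrable M (\<lambda>w. 1 :: real)" by simp
  then have "integrable lborel (\<lambda>z. ?C * ?g z * 1)"
    using distributed_integrable[OF D, of "\<lambda>_. 1"] \<sigma> by simp
  then have "integrable lborel ?g"
    using \<sigma> by simp
  then have "integrable lborel (\<lambda>z. ?g ((1 / sqrt 2) *\<^sub>R z))"
    by (rule integrable_lborel_scaleR) simp
  then have half: "integrable lborel (\<lambda>z :: real ^ 'n. ?C * (4 * \<sigma>\<^sup>2) * exp (- (norm z)\<^sup>2 / (4 * \<sigma>\<^sup>2)))"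
    by (simp add: power_mult_distrib power_divide)
  have "integrable lborel (\<lambda>z. ?C * ?g z * (norm z)\<^sup>2)"
  proof (rule Bochner_Integration.integrable_bound[OF half])
    have "?C * ?g z * (norm z)\<^sup>2 \<le> ?C * (4 * \<sigma>\<^sup>2) * exp (- (norm z)\<^sup>2 / (4 * \<sigma>\<^sup>2))" for z
    proof -
      \<comment> \<open>One half of the exponent absorbs the square of the norm, since \<open>u * exp (- u) \<le> 1\<close>.\<close>
      define u where "u = (norm z)\<^sup>2 / (4 * \<sigma>\<^sup>2)"
      have z: "(norm z)\<^sup>2 = 4 * \<sigma>\<^sup>2 * u" "- (norm z)\<^sup>2 / (2 * \<sigma>\<^sup>2) = - u + - u"
        "- (norm z)\<^sup>2 / (4 * \<sigma>\<^sup>2) = - u"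
        using \<sigma> by (auto simp: u_def field_simps)
      have "u * exp (- u) \<le> 1"
        using order_trans[OF _ exp_ge_add_one_self[of u], of u] by (simp add: exp_minus field_simps)
      then have "(?C * (4 * \<sigma>\<^sup>2) * exp (- u)) * (u * exp (- u)) \<le> (?C * (4 * \<sigma>\<^sup>2) * exp (- u)) * 1"
        using \<sigma> by (intro mult_left_mono) auto
      then show ?thesis
        unfolding z(2,3) unfolding z(1) exp_add by (simp only: mult_ac mult_1_right)
    qed
    then show "AE z in lborel. norm (?C * ?g z * (norm z)\<^sup>2)
        \<le> norm (?C * (4 * \<sigma>\<^sup>2) * exp (- (norm z)\<^sup>2 / (4 * \<sigma>\<^sup>2)))"
      using \<sigma> by (simp add: abs_mult)
  qed measurable
  then show ?thesis
    using distributed_integrable[OF D, of "\<lambda>z. (norm z)\<^sup>2"] \<sigma> by simp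
qed

lemma isotropic_gaussian_integrable_mult:
  fixes \<epsilon> :: "'w \<Rightarrow> real ^ 'n::finite" and h :: "real ^ 'n \<Rightarrow> real"
  assumes M: "prob_space M" and \<sigma>: "0 < \<sigma>" and \<epsilon>: "isotropic_gaussian M \<sigma> \<epsilon>"
    and [measurable]: "h \<in> borel_measurable borel" and h: "\<And>z. \<bar>h z\<bar> \<le> A + B * norm z"
  shows "integrable M (\<lambda>w. h (\<epsilon> w) * \<epsilon> w $ i)"
proof -
  interpret prob_space M by fact
  have [measurable]: "\<epsilon> \<in> borel_measurable M"
    by (rule isotropic_gaussian_measurable[OF \<epsilon>])
  have meas [measurable]: "(\<lambda>w. \<epsilon> w $ i) \<in> borel_measurable M"
    by (rule measurable_compose[OF _ borel_measurable_nth]) measurable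
  have "integrable M (\<lambda>w. \<bar>A\<bar> + (\<bar>A\<bar> + \<bar>B\<bar>) * (norm (\<epsilon> w))\<^sup>2)"
    using isotropic_gaussian_square_integrable[OF M \<sigma> \<epsilon>] by simp
  then show ?thesis
  proof (rule Bochner_Integration.integrable_bound)
    have "\<bar>h z * z $ i\<bar> \<le> \<bar>A\<bar> + (\<bar>A\<bar> + \<bar>B\<bar>) * (norm z)\<^sup>2" for z
    proof -
      have "A + B * norm z \<le> \<bar>A\<bar> + \<bar>B\<bar> * norm z"
        by (intro add_mono mult_right_mono) auto
      then have "\<bar>h z * z $ i\<bar> \<le> (\<bar>A\<bar> + \<bar>B\<bar> * norm z) * norm z"
        unfolding abs_mult using h[of z] component_le_norm_cart[of z i]
        by (intro mult_mono) auto
      moreover have "norm z \<le> 1 + (norm z)\<^sup>2"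
        using sum_power2_ge_zero[of "norm z - 1" "norm z"] by (simp add: power2_eq_square algebra_simps)
      then have "\<bar>A\<bar> * norm z \<le> \<bar>A\<bar> * (1 + (norm z)\<^sup>2)"
        by (intro mult_left_mono) auto
      ultimately show ?thesis by (simp add: algebra_simps power2_eq_square)
    qed
    then show "AE w in M. norm (h (\<epsilon> w) * \<epsilon> w $ i) \<le> norm (\<bar>A\<bar> + (\<bar>A\<bar> + \<bar>B\<bar>) * (norm (\<epsilon> w))\<^sup>2)"
      by (auto intro!: always_eventually order_trans[OF _ abs_ge_self])
  qed measurable
qed

text \<open>The density is invariant under changing the sign of the \<open>i\<close>-th coordinate. Averaging the
  integrand with its reflection therefore does not change the integral, and turns it into half of
  \<open>(h z - h (reflect i z)) * z $ i\<close> times the density, whose two factors have the same sign.\<close>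

lemma isotropic_gaussian_covariance_nonneg:
  fixes \<epsilon> :: "'w \<Rightarrow> real ^ 'n::finite" and h :: "real ^ 'n \<Rightarrow> real"
  assumes \<sigma>: "0 < \<sigma>" and \<epsilon>: "isotropic_gaussian M \<sigma> \<epsilon>"
    and [measurable]: "h \<in> borel_measurable borel"
    and int: "integrable M (\<lambda>w. h (\<epsilon> w) * \<epsilon> w $ i)"
    and mono: "\<And>y z. (\<And>k. k \<noteq> i \<Longrightarrow> z $ k = y $ k) \<Longrightarrow> y $ i \<le> z $ i \<Longrightarrow> h y \<le> h z"
  shows "0 \<le> (LINT w|M. h (\<epsilon> w) * \<epsilon> w $ i)"
proof -
  define \<phi> :: "real ^ 'n \<Rightarrow> real"
    where "\<phi> z = (1 / sqrt (2 * pi * \<sigma>\<^sup>2)) ^ CARD('n) * exp (- (norm z)\<^sup>2 / (2 * \<sigma>\<^sup>2))" for z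
  have [measurable]: "\<phi> \<in> borel_measurable borel"
    unfolding \<phi>_def[abs_def] by measurable
  have \<phi>: "0 \<le> \<phi> z" "\<phi> (reflect i z) = \<phi> z" for z
    using \<sigma> by (auto simp: \<phi>_def norm_reflect)
  have D: "distributed M lborel \<epsilon> (\<lambda>z. ennreal (\<phi> z))"
    using \<epsilon> unfolding isotropic_gaussian_def prod_normal_density_eq \<phi>_def .
  define f where "f z = \<phi> z * (h z * z $ i)" for z
  have [measurable]: "f \<in> borel_measurable borel"
    unfolding f_def[abs_def] by measurable
  have f: "integrable lborel f" "(LINT w|M. h (\<epsilon> w) * \<epsilon> w $ i) = (LINT z|lborel. f z)"
    unfolding f_def[abs_def]
    using distributed_integrable[OF D, of "\<lambda>z. h z * z $ i"]
      distributed_integral[OF D, of "\<lambda>z. h z * z $ i"] \<phi>(1) int by simp_all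
  have "integrable (distr lborel borel (reflect i)) f"
    "(LINT z|distr lborel borel (reflect i). f z) = (LINT z|lborel. f z)"
    using f(1) by (simp_all add: distr_lborel_reflect)
  then have f': "integrable lborel (\<lambda>z. f (reflect i z))"
    "(LINT z|lborel. f (reflect i z)) = (LINT z|lborel. f z)"
    by (simp_all add: integrable_distr_eq integral_distr)
  have "0 \<le> (LINT z|lborel. f z + f (reflect i z))"
  proof (rule Bochner_Integration.integral_nonneg)
    fix z
    have "f z + f (reflect i z) = \<phi> z * ((h z - h (reflect i z)) * z $ i)"
      unfolding f_def \<phi>(2) by (simp add: reflect_def algebra_simps)
    moreover have "0 \<le> (h z - h (reflect i z)) * z $ i"
    proof (cases "0 \<le> z $ i")
      case True
      then have "h (reflect i z) \<le> h z" by (intro mono) (auto simp: reflect_def)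
      with True show ?thesis by simp
    next
      case False
      then have "h z \<le> h (reflect i z)" by (intro mono) (auto simp: reflect_def)
      with False show ?thesis by (simp add: mult_nonpos_nonpos)
    qed
    ultimately show "0 \<le> f z + f (reflect i z)" using \<phi>(1) by simp
  qed
  also have "\<dots> = 2 * (LINT z|lborel. f z)"
    using f(1) f' by simp
  finally show ?thesis using f(2) by simp
qed

text \<open>Constants are nondecreasing, so \<open>1\<close> and \<open>- 1\<close> both have nonnegative covariance with the
  coordinate.\<close>

lemma isotropic_gaussian_mean_zero:
  fixes \<epsilon> :: "'w \<Rightarrow> real ^ 'n::finite"
  assumes M: "prob_space M" and \<sigma>: "0 < \<sigma>" and \<epsilon>: "isotropic_gaussian M \<sigma> \<epsilon>"
  shows "integrable M (\<lambda>w. \<epsilon> w $ i)" and "(LINT w|M. \<epsilon> w $ i) = 0"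
proof -
  have const: "integrable M (\<lambda>w. c * \<epsilon> w $ i)" for c
    using isotropic_gaussian_integrable_mult[OF M \<sigma> \<epsilon>, of "\<lambda>_. c" "\<bar>c\<bar>" 0] by simp
  have nonneg: "0 \<le> (LINT w|M. c * \<epsilon> w $ i)" for c
    using isotropic_gaussian_covariance_nonneg[OF \<sigma> \<epsilon>, of "\<lambda>_. c" i] const by simp
  show "integrable M (\<lambda>w. \<epsilon> w $ i)" "(LINT w|M. \<epsilon> w $ i) = 0"
    using const[of 1] nonneg[of 1] nonneg[of "- 1"] by simp_all
qed

section \<open>Degrees of freedom\<close>

lemma degrees_of_freedom_mono:
  fixes x :: "'n::finite \<Rightarrow> 'a" and \<epsilon> :: "'w \<Rightarrow> real ^ 'n"
  assumes order: "inj x" "partial_order_on (range x) r"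
    and M: "prob_space M" and \<sigma>: "0 < \<sigma>" and \<epsilon>: "isotropic_gaussian M \<sigma> \<epsilon>"
    and \<gamma>: "0 \<le> \<gamma>" "\<gamma> \<le> \<gamma>'"
  shows "degrees_of_freedom M \<sigma> (\<lambda>w. \<theta>star + \<epsilon> w) (bounded_isotonic_estimator x r \<gamma>)
    \<le> degrees_of_freedom M \<sigma> (\<lambda>w. \<theta>star + \<epsilon> w) (bounded_isotonic_estimator x r \<gamma>')"
proof -
  interpret prob_space M by fact
  have \<gamma>': "0 \<le> \<gamma>'" using \<gamma> by linarith
  define P where "P \<gamma> i z = bounded_isotonic_estimator x r \<gamma> (\<theta>star + z) $ i" for \<gamma> i z
  \<comment> \<open>The centred coordinates of the estimate as functions of the noise. Since the noise has mean
    zero, each covariance is the expectation of such a function times a noise coordinate, and the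
    constants subtracted do not affect monotonicity.\<close>
  define X where "X \<gamma> i z = P \<gamma> i z - (LINT v|M. P \<gamma> i (\<epsilon> v))" for \<gamma> i z
  have meas: "X c i \<in> borel_measurable borel" if "0 \<le> c" for c i
    unfolding X_def P_def
    by (intro borel_measurable_continuous_onI continuous_intros
        continuous_on_compose2[OF continuous_on_estimator[OF that, of UNIV]]) auto
  have growth: "\<bar>X c i z\<bar> \<le> (\<bar>P c i 0\<bar> + \<bar>LINT v|M. P c i (\<epsilon> v)\<bar>) + 1 * norm z" if "0 \<le> c" for c i z
  proof -
    let ?e = "bounded_isotonic_estimator x r c"
    have "\<bar>P c i z - P c i 0\<bar> \<le> norm (?e (\<theta>star + z) - ?e \<theta>star)"
      unfolding P_def using component_le_norm_cart[of "?e (\<theta>star + z) - ?e \<theta>star" i] by simp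
    also have "\<dots> \<le> norm z"
      using dist_estimator_le[OF that, of x r "\<theta>star + z" \<theta>star] by (simp add: dist_norm)
    finally show ?thesis unfolding X_def by linarith
  qed
  have int: "integrable M (\<lambda>w. X c i (\<epsilon> w) * \<epsilon> w $ i)" if "0 \<le> c" for c i
    by (rule isotropic_gaussian_integrable_mult[OF M \<sigma> \<epsilon> meas[OF that] growth[OF that]])
  have cov: "covariance M (\<lambda>w. bounded_isotonic_estimator x r c (\<theta>star + \<epsilon> w) $ i) (\<lambda>w. (\<theta>star + \<epsilon> w) $ i)
      = (LINT w|M. X c i (\<epsilon> w) * \<epsilon> w $ i)" for c i
    unfolding covariance_def X_def P_def
    using isotropic_gaussian_mean_zero[OF M \<sigma> \<epsilon>] by (simp add: prob_space)
  have "(LINT w|M. X \<gamma> i (\<epsilon> w) * \<epsilon> w $ i) \<le> (LINT w|M. X \<gamma>' i (\<epsilon> w) * \<epsilon> w $ i)" for i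
  proof -
    have "0 \<le> (LINT w|M. (X \<gamma>' i (\<epsilon> w) - X \<gamma> i (\<epsilon> w)) * \<epsilon> w $ i)"
    proof (rule isotropic_gaussian_covariance_nonneg[OF \<sigma> \<epsilon>])
      show "(\<lambda>z. X \<gamma>' i z - X \<gamma> i z) \<in> borel_measurable borel"
        using meas[OF \<gamma>'] meas[OF \<gamma>(1)] by measurable
      show "integrable M (\<lambda>w. (X \<gamma>' i (\<epsilon> w) - X \<gamma> i (\<epsilon> w)) * \<epsilon> w $ i)"
        using int[OF \<gamma>'] int[OF \<gamma>(1)] by (simp add: left_diff_distrib)
      fix y z :: "real ^ 'n"
      assume "\<And>k. k \<noteq> i \<Longrightarrow> z $ k = y $ k" and "y $ i \<le> z $ i"
      then show "X \<gamma>' i y - X \<gamma> i y \<le> X \<gamma>' i z - X \<gamma> i z"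
        using estimator_gap_mono[OF order \<gamma>, of i "\<theta>star + z" "\<theta>star + y"]
        unfolding X_def P_def by simp
    qed
    then show ?thesis
      using int[OF \<gamma>'] int[OF \<gamma>(1)] by (simp add: left_diff_distrib)
  qed
  then show ?thesis
    unfolding degrees_of_freedom_def cov by (intro mult_left_mono sum_mono) auto
qed

theorem theorem5p4:
  fixes x :: "'n::finite \<Rightarrow> 'a" and r :: "'a rel"
  assumes distinct: "inj x"
    and order: "partial_order_on (range x) r"
  shows "(\<forall>y :: real ^ 'n. mono_on {0..} (\<lambda>\<gamma>. estimator_divergence x r \<gamma> y)) \<and>
    (\<forall>(M :: 'w measure) (\<epsilon> :: 'w \<Rightarrow> real ^ 'n) (\<theta>star :: real ^ 'n) (\<sigma> :: real).
       prob_space M \<and> \<sigma> > 0 \<and> isotropic_gaussian M \<sigma> \<epsilon> \<longrightarrow>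
       mono_on {0..} (\<lambda>\<gamma>. degrees_of_freedom M \<sigma> (\<lambda>w. \<theta>star + \<epsilon> w)
                              (bounded_isotonic_estimator x r \<gamma>)))"
proof (intro conjI allI impI)
  show "mono_on {0..} (\<lambda>\<gamma>. estimator_divergence x r \<gamma> y)" for y :: "real ^ 'n"
    unfolding estimator_divergence_def
    by (intro mono_onI num_components_antimono active_edges_antimono[OF distinct order]) auto
  show "mono_on {0..} (\<lambda>\<gamma>. degrees_of_freedom M \<sigma> (\<lambda>w. \<theta>star + \<epsilon> w)
      (bounded_isotonic_estimator x r \<gamma>))"
    if "prob_space M \<and> \<sigma> > 0 \<and> isotropic_gaussian M \<sigma> \<epsilon>"
    for M :: "'w measure" and \<epsilon> :: "'w \<Rightarrow> real ^ 'n" and \<theta>star \<sigma>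
    using that by (intro mono_onI degrees_of_freedom_mono[OF distinct order]) auto
qed

end
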